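(* Let points $M_1,\dots,M_N\in\mathbb R^k$ with masses $m_1,\dots,m_N>0$ be given, not all contained in one hyperplane, with total mass $m$, center of masses $C$ and central principal hyperplanar moments of inertia $0<J_1<\dots<J_k$. Use Cartesian coordinates with origin $C$ along the principal axes at $C$ and consider the associated pencil of confocal quadrics $$\frac{x_1^2}{\frac{J_1}{m}-\lambda}+\frac{x_2^2}{\frac{J_1}{m}-a_2^2-\lambda}+\dots+\frac{x_k^2}{\frac{J_1}{m}-a_k^2-\lambda}=1,\qquad a_s^2=\frac{J_s-J_1}{m}.$$ Let $P=(x_{01},\dots,x_{0k})$ be a point with Jacobi coordinates $\lambda_1<\dots<\lambda_k$ with respect to this pencil. The parameters $\lambda_1,\dots,\lambda_k$ determine the $k$ orthogonal quadrics from the pencil containing $P$. The tangent hyperplanes at $P$ to these quadrics are the critical points of the hyperplanar moment $\pi\mapsto J_\pi$ on the set of hyperplanes $\pi$ which contain $P$. The hyperplane which is the best fit to the given system of points among the hyperplanes that contain $P$ is the tangent hyperplane at $P$ to the quadric from the pencil with parameter $\lambda_k$. Similarly, the hyperplane which is the worst fit to the given system of points among the hyperplanes that contain $P$ is the tangent hyperplane at $P$ to the quadric from the pencil with parameter $\lambda_1$.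
   Context: For a hyperplane $\pi$, the hyperplanar moment of inertia is $J_\pi=\sum_{i=1}^N m_i d_i^2$, with $d_i$ the perpendicular distance from $M_i$ to $\pi$. Best fit (worst fit) among a set of hyperplanes means minimizing (maximizing) $J_\pi$ over this set. The hyperplanes through $P$ are parametrized by their unit normal vectors (up to sign), and critical points are taken with respect to this parametrization. The central hyperplanar operator of inertia $J_C$ is the symmetric operator with $\langle J_C\mathbf n_1,\mathbf n_2\rangle=\sum_{j} m_j\langle \mathbf r_j,\mathbf n_1\rangle\langle\mathbf r_j,\mathbf n_2\rangle$, $\mathbf r_j=M_j-C$; its eigenvalues are $J_1,\dots,J_k$ and its orthonormal eigenvectors are the principal axes at $C$ (the $x_i$-axis corresponds to $J_i$). Write $\alpha_1=J_1/m$, $\alpha_s=J_1/m-a_s^2$ for $s\ge2$. The Jacobi coordinates of $P$ are the solutions $\lambda$ of the pencil equation with $x_i=x_{0i}$, i.e. the roots of $\prod_i(\alpha_i-\lambda)-\sum_i x_{0i}^2\prod_{j\neq i}(\alpha_j-\lambda)=0$. Degenerate members: for $\lambda=\alpha_i$ the member of the pencil is the coordinate hyperplane $x_i=0$, which is its own tangent hyperplane. Quadrics through $P$ are orthogonal if their tangent hyperplanes at $P$ are. *)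

theory Defs
  imports "HOL-Analysis.Analysis"
begin

section \<open>Hyperplanes\<close>

definition hyperplane :: "'a::euclidean_space set \<Rightarrow> bool" where
  "hyperplane S \<longleftrightarrow> (\<exists>a b. a \<noteq> 0 \<and> S = {x. a \<bullet> x = b})"

definition hyperplanes_through :: "'a::euclidean_space \<Rightarrow> 'a set set" where
  "hyperplanes_through P = {S. hyperplane S \<and> P \<in> S}"

definition hyperplane_at :: "'a::euclidean_space \<Rightarrow> 'a \<Rightarrow> 'a set" where
  "hyperplane_at P n = {x. n \<bullet> (x - P) = 0}"

definition orthogonal_hyperplanes :: "'a::euclidean_space set \<Rightarrow> 'a set \<Rightarrow> bool" where
  "orthogonal_hyperplanes S T \<longleftrightarrow>
     (\<exists>a b c d. a \<noteq> 0 \<and> c \<noteq> 0 \<and> S = {x. a \<bullet> x = b} \<and> T = {x. c \<bullet> x = d} \<and> orthogonal a c)"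

text \<open>Unit normals parametrize the hyperplanes through P. A unit normal is critical for
  a function F of hyperplanes if the differential of the induced function on the unit sphere
  vanishes there, that is, if the zero map is a derivative at n within the sphere.
  The normals n and -n give the same hyperplane and are critical simultaneously.\<close>

definition critical_hyperplane :: "('a::euclidean_space set \<Rightarrow> real) \<Rightarrow> 'a \<Rightarrow> 'a set \<Rightarrow> bool" where
  "critical_hyperplane F P S \<longleftrightarrow>
     (\<exists>n \<in> sphere 0 1. S = hyperplane_at P n \<and>
        ((\<lambda>u. F (hyperplane_at P u)) has_derivative (\<lambda>_. 0)) (at n within sphere 0 1))"

text \<open>The affine tangent space at P of a subset S: all points P + v with v the velocity
  at time 0 of a curve that passes through P at time 0 and stays in S for small times.
  A hyperplane is its own tangent space at each of its points.\<close>

definition tangent_at :: "'a::euclidean_space set \<Rightarrow> 'a \<Rightarrow> 'a set" where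
  "tangent_at S P = {P + v | v. \<exists>\<gamma> :: real \<Rightarrow> 'a.
     \<gamma> 0 = P \<and> (\<forall>\<^sub>F t in nhds 0. \<gamma> t \<in> S) \<and> (\<gamma> has_vector_derivative v) (at 0)}"

section \<open>Moments of inertia of N weighted points\<close>

definition total_mass :: "nat \<Rightarrow> (nat \<Rightarrow> real) \<Rightarrow> real" where
  "total_mass N m = (\<Sum>j=1..N. m j)"

definition mass_center :: "nat \<Rightarrow> (nat \<Rightarrow> real) \<Rightarrow> (nat \<Rightarrow> 'a) \<Rightarrow> 'a::euclidean_space" where
  "mass_center N m M = (1 / total_mass N m) *\<^sub>R (\<Sum>j=1..N. m j *\<^sub>R M j)"

definition hyperplanar_moment ::
    "nat \<Rightarrow> (nat \<Rightarrow> real) \<Rightarrow> (nat \<Rightarrow> 'a) \<Rightarrow> 'a::euclidean_space set \<Rightarrow> real" where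
  "hyperplanar_moment N m M S = (\<Sum>j=1..N. m j * (infdist (M j) S)\<^sup>2)"

definition best_fit ::
    "nat \<Rightarrow> (nat \<Rightarrow> real) \<Rightarrow> (nat \<Rightarrow> 'a) \<Rightarrow> 'a::euclidean_space set set \<Rightarrow> 'a set \<Rightarrow> bool" where
  "best_fit N m M \<H> S \<longleftrightarrow> is_arg_min (hyperplanar_moment N m M) (\<lambda>T. T \<in> \<H>) S"

definition worst_fit ::
    "nat \<Rightarrow> (nat \<Rightarrow> real) \<Rightarrow> (nat \<Rightarrow> 'a) \<Rightarrow> 'a::euclidean_space set set \<Rightarrow> 'a set \<Rightarrow> bool" where
  "worst_fit N m M \<H> S \<longleftrightarrow> is_arg_max (hyperplanar_moment N m M) (\<lambda>T. T \<in> \<H>) S"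

definition central_operator ::
    "nat \<Rightarrow> (nat \<Rightarrow> real) \<Rightarrow> (nat \<Rightarrow> 'a) \<Rightarrow> 'a \<Rightarrow> 'a::euclidean_space" where
  "central_operator N m M n =
     (\<Sum>j=1..N. (m j * ((M j - mass_center N m M) \<bullet> n)) *\<^sub>R (M j - mass_center N m M))"

lemma central_operator_inner:
  "central_operator N m M n1 \<bullet> n2 =
     (\<Sum>j=1..N. m j * ((M j - mass_center N m M) \<bullet> n1) * ((M j - mass_center N m M) \<bullet> n2))"
  by (simp add: central_operator_def inner_sum_left)

text \<open>Orthonormal eigenvectors e 1, ..., e k of the central operator, where k is the dimension;
  e i belongs to the eigenvalue J i, so J 1, ..., J k are all the eigenvalues.\<close>

definition principal_axes ::
    "nat \<Rightarrow> (nat \<Rightarrow> real) \<Rightarrow> (nat \<Rightarrow> 'a) \<Rightarrow> (nat \<Rightarrow> real) \<Rightarrow> (nat \<Rightarrow> 'a::euclidean_space) \<Rightarrow> bool"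
  where
  "principal_axes N m M J e \<longleftrightarrow>
     (\<forall>i \<in> {1..DIM('a)}. \<forall>j \<in> {1..DIM('a)}. e i \<bullet> e j = (if i = j then 1 else 0)) \<and>
     (\<forall>i \<in> {1..DIM('a)}. central_operator N m M (e i) = J i *\<^sub>R e i)"

definition coord :: "'a::euclidean_space \<Rightarrow> (nat \<Rightarrow> 'a) \<Rightarrow> 'a \<Rightarrow> nat \<Rightarrow> real" where
  "coord C e x i = (x - C) \<bullet> e i"

section \<open>The confocal pencil\<close>

text \<open>The first denominator has no a-term; this agrees with a 1 = 0. Note that the
  coefficients decrease as J increases.\<close>

definition a_sq :: "real \<Rightarrow> (nat \<Rightarrow> real) \<Rightarrow> nat \<Rightarrow> real" where
  "a_sq mass J s = (J s - J 1) / mass"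

definition pencil_coeff :: "real \<Rightarrow> (nat \<Rightarrow> real) \<Rightarrow> nat \<Rightarrow> real" where
  "pencil_coeff mass J s = (if s = 1 then J 1 / mass else J 1 / mass - a_sq mass J s)"

definition pencil_quadric ::
    "(nat \<Rightarrow> real) \<Rightarrow> 'a \<Rightarrow> (nat \<Rightarrow> 'a) \<Rightarrow> real \<Rightarrow> 'a::euclidean_space set" where
  "pencil_quadric \<alpha> C e l =
     (if l \<in> \<alpha> ` {1..DIM('a)}
      then {x. \<exists>i \<in> {1..DIM('a)}. l = \<alpha> i \<and> coord C e x i = 0}
      else {x. (\<Sum>i=1..DIM('a). (coord C e x i)\<^sup>2 / (\<alpha> i - l)) = 1})"

definition jacobi_function :: "nat \<Rightarrow> (nat \<Rightarrow> real) \<Rightarrow> (nat \<Rightarrow> real) \<Rightarrow> real \<Rightarrow> real" where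
  "jacobi_function k \<alpha> x l =
     (\<Prod>i=1..k. \<alpha> i - l) - (\<Sum>i=1..k. (x i)\<^sup>2 * (\<Prod>j\<in>{1..k} - {i}. \<alpha> j - l))"

text \<open>Jacobi coordinates in the case of k distinct roots; as the polynomial has degree k,
  all roots are then simple.\<close>

definition jacobi_coordinates ::
    "nat \<Rightarrow> (nat \<Rightarrow> real) \<Rightarrow> (nat \<Rightarrow> real) \<Rightarrow> (nat \<Rightarrow> real) \<Rightarrow> bool" where
  "jacobi_coordinates k \<alpha> x lam \<longleftrightarrow>
     strict_mono_on {1..k} lam \<and> {l. jacobi_function k \<alpha> x l = 0} = lam ` {1..k}"

end

theory Submission
  imports Defs
begin

text \<open>Everything reduces to the spectral decomposition of one symmetric operator. Put \<open>p = P - C\<close>.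
  By the theorem of Steiner (\<open>hyperplanar_moment_steiner\<close>) the moment of the hyperplane through \<open>P\<close>
  with unit normal \<open>u\<close> is \<open>\<Sum>i. J\<^sub>i * u\<^sub>i\<^sup>2 + m * (p \<bullet> u)\<^sup>2\<close>. Since \<open>J\<^sub>i = 2 * J\<^sub>1 - m * \<alpha>\<^sub>i\<close>, this
  equals \<open>2 * J\<^sub>1 - m * (B u \<bullet> u)\<close> with the symmetric operator \<open>B = diag \<alpha> - p p\<^sup>T\<close>. The Jacobi polynomial
  is the characteristic polynomial of \<open>B\<close>, so the Jacobi coordinates of \<open>P\<close> are the eigenvalues of
  \<open>B\<close>, and they are simple.

  The eigenvectors are geometric: a normal at \<open>P\<close> of the member of the pencil with parameter
  \<open>\<lambda>\<close> has the coordinates \<open>p\<^sub>i / (\<alpha>\<^sub>i - \<lambda>)\<close>, and \<open>P\<close> lying on the quadric says exactly that this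
  vector is an eigenvector of \<open>B\<close> for \<open>\<lambda>\<close>; for a degenerate member it is the coordinate
  vector (\<open>pencil_quadric_tangent\<close>).
  Symmetry of \<open>B\<close> makes the \<open>k\<close> normals orthonormal, and in this basis
  the moment is a diagonal form \<open>\<Sum>s. \<mu>\<^sub>s * (u \<bullet> f\<^sub>s)\<^sup>2\<close> with the distinct coefficients
  \<open>\<mu>\<^sub>s = 2 * J\<^sub>1 - m * \<lambda>\<^sub>s\<close>. On the unit sphere such a form is critical only at the basis vectors up to sign
  (\<open>critical_hyperplane_diagonal_iff\<close>), and it has its extrema at those with the
  extreme coefficients (\<open>arg_min_hyperplane_diagonal\<close>, \<open>arg_max_hyperplane_diagonal\<close>). The largest
  \<open>\<lambda>\<^sub>s\<close> gives the smallest \<open>\<mu>\<^sub>s\<close>, hence the best fit.\<close>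

section \<open>Hyperplanes through a point\<close>

lemma mem_hyperplane_at: "x \<in> hyperplane_at P n \<longleftrightarrow> n \<bullet> (x - P) = 0"
  by (simp add: hyperplane_at_def)

lemma hyperplane_at_scaleR:
  "c \<noteq> 0 \<Longrightarrow> hyperplane_at P (c *\<^sub>R n) = hyperplane_at P n"
  by (simp add: hyperplane_at_def)

lemma hyperplane_at_conv: "hyperplane_at P n = {x. n \<bullet> x = n \<bullet> P}"
  by (simp add: hyperplane_at_def inner_diff_right)

text \<open>The point \<open>P + a\<close> lies on the second hyperplane but not on the first.\<close>

lemma hyperplane_at_orthogonal_neq:
  assumes "a \<noteq> 0" "a \<bullet> b = 0"
  shows "hyperplane_at P a \<noteq> hyperplane_at P b"
proof
  assume eq: "hyperplane_at P a = hyperplane_at P b"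
  have "P + a \<in> hyperplane_at P b"
    using assms by (simp add: mem_hyperplane_at inner_commute)
  with eq assms show False
    by (simp add: mem_hyperplane_at flip: eq)
qed

lemma orthogonal_hyperplanes_at:
  assumes "a \<noteq> 0" "b \<noteq> 0" "a \<bullet> b = 0"
  shows "orthogonal_hyperplanes (hyperplane_at P a) (hyperplane_at P b)"
  using assms unfolding orthogonal_hyperplanes_def hyperplane_at_conv orthogonal_def by blast

lemma hyperplanes_through_eq: "hyperplanes_through P = hyperplane_at P ` sphere 0 1"
proof (intro equalityI subsetI)
  fix S assume "S \<in> hyperplanes_through P"
  then obtain a b where a: "a \<noteq> 0" and S: "S = {x. a \<bullet> x = b}" and "P \<in> S"
    by (auto simp: hyperplanes_through_def hyperplane_def)
  then have "S = hyperplane_at P a"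
    by (simp add: hyperplane_at_conv)
  also have "\<dots> = hyperplane_at P (sgn a)"
    using a by (simp add: sgn_div_norm hyperplane_at_scaleR)
  finally show "S \<in> hyperplane_at P ` sphere 0 1"
    using a by (auto simp: norm_sgn intro!: image_eqI[where x = "sgn a"])
next
  fix S assume "S \<in> hyperplane_at P ` sphere 0 1"
  then obtain n where "norm n = 1" and S: "S = hyperplane_at P n"
    by auto
  then have "n \<noteq> 0" by auto
  then show "S \<in> hyperplanes_through P"
    unfolding hyperplanes_through_def hyperplane_def S hyperplane_at_conv by blast
qed

text \<open>The nearest point is the foot \<open>y\<close> of the perpendicular; that no other point is nearer is the
  Cauchy-Schwarz inequality against the unit normal.\<close>

lemma infdist_hyperplane_at:
  assumes "norm n = 1"
  shows "infdist x (hyperplane_at P n) = \<bar>n \<bullet> (x - P)\<bar>"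
proof -
  define y where "y = x - (n \<bullet> (x - P)) *\<^sub>R n"
  have nn: "n \<bullet> n = 1"
    using assms by (simp add: norm_eq_1)
  have y: "y \<in> hyperplane_at P n"
    by (simp add: y_def mem_hyperplane_at inner_diff_right nn)
  have "dist x y = \<bar>n \<bullet> (x - P)\<bar>"
    by (simp add: dist_norm y_def assms)
  then have le: "infdist x (hyperplane_at P n) \<le> \<bar>n \<bullet> (x - P)\<bar>"
    using infdist_le[OF y, of x] by simp
  have "\<bar>n \<bullet> (x - P)\<bar> \<le> dist x z" if "z \<in> hyperplane_at P n" for z
  proof -
    have "n \<bullet> (x - P) = n \<bullet> (x - z)"
      using that by (simp add: mem_hyperplane_at inner_diff_right)
    also have "\<bar>\<dots>\<bar> \<le> norm n * norm (x - z)"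
      by (rule Cauchy_Schwarz_ineq2)
    finally show ?thesis
      using assms by (simp add: dist_norm)
  qed
  then have "\<bar>n \<bullet> (x - P)\<bar> \<le> infdist x (hyperplane_at P n)"
    using y by (auto simp: infdist_def intro!: cINF_greatest)
  with le show ?thesis by simp
qed

section \<open>Orthonormal bases\<close>

text \<open>The basis is an indexed family rather than a set because the eigenvalues and the Jacobi
  coordinates are attached to the index. The cardinality condition forces the family to span.\<close>

definition orthonormal_basis :: "'i set \<Rightarrow> ('i \<Rightarrow> 'a::euclidean_space) \<Rightarrow> bool" where
  "orthonormal_basis I f \<longleftrightarrow> finite I \<and> card I = DIM('a) \<and>
     (\<forall>i\<in>I. \<forall>j\<in>I. f i \<bullet> f j = (if i = j then 1 else 0))"

lemma orthonormal_basisD: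
  assumes "orthonormal_basis I f"
  shows "finite I" "\<And>i j. i \<in> I \<Longrightarrow> j \<in> I \<Longrightarrow> f i \<bullet> f j = (if i = j then 1 else 0)"
    "\<And>i. i \<in> I \<Longrightarrow> norm (f i) = 1"
  using assms by (auto simp: orthonormal_basis_def norm_eq_1)

lemma orthonormal_basis_expansion:
  assumes f: "orthonormal_basis I f"
  shows "(\<Sum>i\<in>I. (x \<bullet> f i) *\<^sub>R f i) = (x :: 'a::euclidean_space)"
proof -
  note D = orthonormal_basisD[OF f]
  have inj: "inj_on f I"
  proof (rule inj_onI)
    fix i j assume *: "i \<in> I" "j \<in> I" "f i = f j"
    show "i = j"
      using D(2)[OF *(1,2)] D(2)[OF *(1,1)] *(3) by (auto split: if_splits)
  qed
  have orth: "pairwise orthogonal (f ` I)"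
    using D(2) by (auto simp: pairwise_def orthogonal_def)
  have indep: "independent (f ` I)"
    using D(3) by (intro pairwise_orthogonal_independent orth) force
  have "card (f ` I) = DIM('a)"
    using f by (simp add: card_image inj orthonormal_basis_def)
  then have "span (f ` I) = UNIV"
    using card_ge_dim_independent[OF _ indep, of UNIV] by auto
  then have "(\<Sum>v\<in>f ` I. (x \<bullet> v) *\<^sub>R v) = x"
    using D by (intro orthonormal_basis_expand orth) auto
  then show ?thesis
    by (simp add: sum.reindex inj)
qed

lemma orthonormal_basis_inner:
  assumes "orthonormal_basis I f"
  shows "x \<bullet> y = (\<Sum>i\<in>I. (x \<bullet> f i) * (y \<bullet> f i))"
proof -
  have "x \<bullet> y = (\<Sum>i\<in>I. (x \<bullet> f i) *\<^sub>R f i) \<bullet> y"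
    by (simp only: orthonormal_basis_expansion[OF assms])
  then show ?thesis
    by (simp add: inner_sum_left inner_commute[of "f _" y])
qed

lemma orthonormal_basis_eqI:
  assumes "orthonormal_basis I f" "\<And>i. i \<in> I \<Longrightarrow> x \<bullet> f i = y \<bullet> f i"
  shows "x = y"
  using orthonormal_basis_expansion[OF assms(1), of x] orthonormal_basis_expansion[OF assms(1), of y]
    assms(2) by (metis (no_types, lifting) sum.cong)

text \<open>Turns vanishing coordinates into a statement on hyperplanes: such a vector \<open>n \<noteq> 0\<close> defines the same
  hyperplane as the basis vector.\<close>

lemma eq_scaleR_of_single_coordinate:
  assumes f: "orthonormal_basis I f" and s: "s \<in> I"
    and zero: "\<And>t. t \<in> I \<Longrightarrow> t \<noteq> s \<Longrightarrow> n \<bullet> f t = 0"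
  shows "n = (n \<bullet> f s) *\<^sub>R f s"
  using f by (rule orthonormal_basis_eqI) (use orthonormal_basisD(2)[OF f] s zero in auto)

section \<open>Quadratic forms on the unit sphere\<close>

text \<open>The Lagrange multiplier rule on the sphere. Along the great circle
  \<open>cos t *\<^sub>R n + sin t *\<^sub>R w\<close> a critical function has derivative zero, so \<open>q'\<close> vanishes on all
  \<open>w\<close> orthogonal to \<open>n\<close> and is a multiple of the inner product with \<open>n\<close>. Conversely,
  subtracting the multiple \<open>c / 2\<close> of \<open>u \<bullet> u - 1\<close>, which vanishes on the sphere, removes the derivative
  without changing the function there.\<close>

lemma sphere_critical_iff:
  fixes q :: "'a::euclidean_space \<Rightarrow> real"
  assumes q: "(q has_derivative q') (at n)" and n: "norm n = 1"
  shows "(q has_derivative (\<lambda>_. 0)) (at n within sphere 0 1) \<longleftrightarrow> (\<exists>c. \<forall>h. q' h = c * (n \<bullet> h))"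
proof
  assume crit: "(q has_derivative (\<lambda>_. 0)) (at n within sphere 0 1)"
  have nn: "n \<bullet> n = 1"
    using n by (simp add: norm_eq_1)
  interpret bounded_linear q'
    using q by (rule has_derivative_bounded_linear)
  have unit: "q' w = 0" if w: "norm w = 1" "n \<bullet> w = 0" for w
  proof -
    define \<gamma> where "\<gamma> t = cos t *\<^sub>R n + sin t *\<^sub>R w" for t :: real
    have \<gamma>0: "\<gamma> 0 = n" by (simp add: \<gamma>_def)
    have ww: "w \<bullet> w = 1" using w by (simp add: norm_eq_1)
    have wn: "w \<bullet> n = 0" using w by (simp add: inner_commute)
    have sph: "\<gamma> t \<in> sphere 0 1" for t
      by (simp add: \<gamma>_def norm_eq_1 inner_add_left inner_add_right nn ww wn w
          flip: power2_eq_square)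
    have der: "(\<gamma> has_derivative (\<lambda>t. t *\<^sub>R w)) (at 0)"
      unfolding \<gamma>_def by (auto intro!: derivative_eq_intros)
    have "((\<lambda>t. q (\<gamma> t)) has_derivative (\<lambda>t. 0)) (at 0 within UNIV)"
    proof (rule has_derivative_in_compose[OF der])
      show "(q has_derivative (\<lambda>_. 0)) (at (\<gamma> 0) within range \<gamma>)"
        unfolding \<gamma>0 by (rule has_derivative_subset[OF crit]) (use sph in blast)
    qed
    moreover have "((\<lambda>t. q (\<gamma> t)) has_derivative (\<lambda>t. q' (t *\<^sub>R w))) (at 0 within UNIV)"
      using has_derivative_compose[OF der, of q q'] q unfolding \<gamma>0 .
    ultimately have "(\<lambda>t::real. 0) = (\<lambda>t. q' (t *\<^sub>R w))"
      by (rule has_derivative_unique)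
    from fun_cong[OF this, of 1] show ?thesis by simp
  qed
  have perp: "q' w = 0" if "n \<bullet> w = 0" for w
  proof (cases "w = 0")
    case False
    have "q' w = norm w * q' (sgn w)"
      using False by (simp flip: scale real_scaleR_def)
        (simp add: sgn_div_norm)
    also have "q' (sgn w) = 0"
      using False that by (intro unit) (auto simp: norm_sgn sgn_div_norm)
    finally show ?thesis by simp
  qed (simp add: zero)
  have "q' h = q' n * (n \<bullet> h)" for h
  proof -
    have "q' (h - (n \<bullet> h) *\<^sub>R n) = 0"
      by (rule perp) (simp add: inner_diff_right nn)
    then show ?thesis
      by (simp add: diff scale)
  qed
  then show "\<exists>c. \<forall>h. q' h = c * (n \<bullet> h)" by blast
next
  assume "\<exists>c. \<forall>h. q' h = c * (n \<bullet> h)"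
  then obtain c where c: "\<And>h. q' h = c * (n \<bullet> h)" by blast
  have "((\<lambda>u. q u - c / 2 * (u \<bullet> u) + c / 2) has_derivative (\<lambda>_. 0)) (at n within sphere 0 1)"
    by (rule derivative_eq_intros refl has_derivative_at_withinI[OF q])+
      (auto simp: c inner_commute)
  then show "(q has_derivative (\<lambda>_. 0)) (at n within sphere 0 1)"
    by (rule has_derivative_transform_within[OF _ zero_less_one])
      (use n in \<open>auto simp: norm_eq_1\<close>)
qed

text \<open>With a multiplier \<open>c\<close> the critical equation reads \<open>2 * \<mu>\<^sub>s * n\<^sub>s = c * n\<^sub>s\<close> in every coordinate.
  As the coefficients are distinct, only one coordinate of \<open>n\<close> can be nonzero.\<close>

lemma critical_hyperplane_diagonal_iff:
  assumes f: "orthonormal_basis I f" and inj: "inj_on \<mu> I"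
    and F: "\<And>u. norm u = 1 \<Longrightarrow> F (hyperplane_at P u) = (\<Sum>s\<in>I. \<mu> s * (u \<bullet> f s)\<^sup>2)"
  shows "critical_hyperplane F P S \<longleftrightarrow> S \<in> (\<lambda>s. hyperplane_at P (f s)) ` I"
proof -
  note D = orthonormal_basisD[OF f]
  define q where "q u = (\<Sum>s\<in>I. \<mu> s * (u \<bullet> f s)\<^sup>2)" for u
  have q_der: "(q has_derivative (\<lambda>h. \<Sum>s\<in>I. 2 * \<mu> s * (n \<bullet> f s) * (h \<bullet> f s))) (at n)" for n
    unfolding q_def
    by (auto intro!: derivative_eq_intros sum.cong simp: algebra_simps)
  have crit: "((\<lambda>u. F (hyperplane_at P u)) has_derivative (\<lambda>_. 0)) (at n within sphere 0 1) \<longleftrightarrow>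
      (\<exists>c. \<forall>h. (\<Sum>s\<in>I. 2 * \<mu> s * (n \<bullet> f s) * (h \<bullet> f s)) = c * (n \<bullet> h))"
    if n: "norm n = 1" for n
  proof -
    have "((\<lambda>u. F (hyperplane_at P u)) has_derivative (\<lambda>_. 0)) (at n within sphere 0 1) \<longleftrightarrow>
        (q has_derivative (\<lambda>_. 0)) (at n within sphere 0 1)"
      using n by (auto simp: F q_def elim!: has_derivative_transform[rotated 2])
    then show ?thesis
      using sphere_critical_iff[OF q_der n] by simp
  qed
  show ?thesis
  proof
    assume "critical_hyperplane F P S"
    then obtain n where n: "norm n = 1" and S: "S = hyperplane_at P n"
      and "((\<lambda>u. F (hyperplane_at P u)) has_derivative (\<lambda>_. 0)) (at n within sphere 0 1)"
      by (auto simp: critical_hyperplane_def)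
    then obtain c where c: "\<And>h. (\<Sum>s\<in>I. 2 * \<mu> s * (n \<bullet> f s) * (h \<bullet> f s)) = c * (n \<bullet> h)"
      using crit by blast
    have eig: "2 * \<mu> t * (n \<bullet> f t) = c * (n \<bullet> f t)" if t: "t \<in> I" for t
    proof -
      have "(\<Sum>s\<in>I. 2 * \<mu> s * (n \<bullet> f s) * (f t \<bullet> f s)) =
          (\<Sum>s\<in>I. if s = t then 2 * \<mu> s * (n \<bullet> f s) else 0)"
        using t D(2) by (intro sum.cong) auto
      then show ?thesis
        using c[of "f t"] t D(1) by auto
    qed
    have "\<exists>s\<in>I. n \<bullet> f s \<noteq> 0"
    proof (rule ccontr)
      assume "\<not> ?thesis"
      then have "n = 0"
        by (intro orthonormal_basis_eqI[OF f]) auto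
      with n show False by simp
    qed
    then obtain s where s: "s \<in> I" "n \<bullet> f s \<noteq> 0" by blast
    have "n \<bullet> f t = 0" if t: "t \<in> I" "t \<noteq> s" for t
    proof (rule ccontr)
      assume "n \<bullet> f t \<noteq> 0"
      then have "\<mu> t = \<mu> s"
        using eig[OF t(1)] eig[OF s(1)] s(2) by simp
      with inj t s(1) show False by (auto dest: inj_onD)
    qed
    then have "n = (n \<bullet> f s) *\<^sub>R f s"
      by (rule eq_scaleR_of_single_coordinate[OF f s(1)])
    then have "S = hyperplane_at P (f s)"
      unfolding S using hyperplane_at_scaleR[OF s(2)] by metis
    with s show "S \<in> (\<lambda>s. hyperplane_at P (f s)) ` I" by blast
  next
    assume "S \<in> (\<lambda>s. hyperplane_at P (f s)) ` I"
    then obtain t where t: "t \<in> I" and S: "S = hyperplane_at P (f t)" by blast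
    have "(\<Sum>s\<in>I. 2 * \<mu> s * (f t \<bullet> f s) * (h \<bullet> f s)) = 2 * \<mu> t * (f t \<bullet> h)" for h
    proof -
      have "(\<Sum>s\<in>I. 2 * \<mu> s * (f t \<bullet> f s) * (h \<bullet> f s)) =
          (\<Sum>s\<in>I. if s = t then 2 * \<mu> s * (h \<bullet> f s) else 0)"
        using t D(2) by (intro sum.cong) auto
      then show ?thesis
        using t D(1) by (simp add: inner_commute)
    qed
    then show "critical_hyperplane F P S"
      unfolding critical_hyperplane_def using S D(3)[OF t] crit[OF D(3)[OF t]]
      by (intro bexI[of _ "f t"]) auto
  qed
qed

text \<open>On the unit sphere the squared coordinates sum to 1, so the value exceeds the least coefficient by
  \<open>\<Sum>s. (\<mu>\<^sub>s - \<mu>\<^sub>0) * u\<^sub>s\<^sup>2\<close>. This is nonnegative, and zero only if every coordinate except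
  the one with the least coefficient vanishes, which gives uniqueness.\<close>

lemma arg_min_hyperplane_diagonal:
  fixes F :: "'a::euclidean_space set \<Rightarrow> real"
  assumes f: "orthonormal_basis I f" and s0: "s\<^sub>0 \<in> I"
    and less: "\<And>s. s \<in> I \<Longrightarrow> s \<noteq> s\<^sub>0 \<Longrightarrow> \<mu> s\<^sub>0 < \<mu> s"
    and F: "\<And>u. norm u = 1 \<Longrightarrow> F (hyperplane_at P u) = (\<Sum>s\<in>I. \<mu> s * (u \<bullet> f s)\<^sup>2)"
  shows "{S. is_arg_min F (\<lambda>T. T \<in> hyperplanes_through P) S} = {hyperplane_at P (f s\<^sub>0)}"
proof -
  note D = orthonormal_basisD[OF f]
  have gap: "F (hyperplane_at P u) = \<mu> s\<^sub>0 + (\<Sum>s\<in>I. (\<mu> s - \<mu> s\<^sub>0) * (u \<bullet> f s)\<^sup>2)"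
    if u: "norm u = 1" for u
  proof -
    have "(\<Sum>s\<in>I. (u \<bullet> f s)\<^sup>2) = 1"
      using orthonormal_basis_inner[OF f, of u u] u by (simp add: norm_eq_1 power2_eq_square)
    then show ?thesis
      using F[OF u] by (simp add: left_diff_distrib sum_subtractf flip: sum_distrib_left)
  qed
  have nonneg: "0 \<le> (\<mu> s - \<mu> s\<^sub>0) * (u \<bullet> f s)\<^sup>2" if "s \<in> I" for s u
    using less[OF that] by (cases "s = s\<^sub>0") auto
  have val: "F (hyperplane_at P (f s\<^sub>0)) = \<mu> s\<^sub>0"
  proof -
    have "(\<Sum>s\<in>I. (\<mu> s - \<mu> s\<^sub>0) * (f s\<^sub>0 \<bullet> f s)\<^sup>2) = 0"
      using D(2)[OF s0] by (intro sum.neutral) auto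
    then show ?thesis using gap[OF D(3)[OF s0]] by simp
  qed
  have mem: "hyperplane_at P (f s\<^sub>0) \<in> hyperplanes_through P"
    using D(3)[OF s0] by (auto simp: hyperplanes_through_eq)
  have min: "\<mu> s\<^sub>0 \<le> F T" if "T \<in> hyperplanes_through P" for T
    using that gap nonneg by (auto simp: hyperplanes_through_eq sum_nonneg)
  have uniq: "S = hyperplane_at P (f s\<^sub>0)" if "S \<in> hyperplanes_through P" "F S \<le> \<mu> s\<^sub>0" for S
  proof -
    obtain u where u: "norm u = 1" and S: "S = hyperplane_at P u"
      using \<open>S \<in> _\<close> by (auto simp: hyperplanes_through_eq)
    have "(\<Sum>s\<in>I. (\<mu> s - \<mu> s\<^sub>0) * (u \<bullet> f s)\<^sup>2) = 0"
      using gap[OF u] \<open>F S \<le> _\<close> S sum_nonneg[of I "\<lambda>s. (\<mu> s - \<mu> s\<^sub>0) * (u \<bullet> f s)\<^sup>2"] nonneg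
      by force
    then have "\<forall>s\<in>I. (\<mu> s - \<mu> s\<^sub>0) * (u \<bullet> f s)\<^sup>2 = 0"
      by (subst (asm) sum_nonneg_eq_0_iff) (use D(1) nonneg in auto)
    then have "u \<bullet> f s = 0" if "s \<in> I" "s \<noteq> s\<^sub>0" for s
      using that less[OF that] by auto
    then have *: "u = (u \<bullet> f s\<^sub>0) *\<^sub>R f s\<^sub>0"
      by (rule eq_scaleR_of_single_coordinate[OF f s0])
    with u have "u \<bullet> f s\<^sub>0 \<noteq> 0" by auto
    then show ?thesis
      unfolding S using * hyperplane_at_scaleR by metis
  qed
  show ?thesis
  proof (intro equalityI subsetI)
    fix S assume "S \<in> {S. is_arg_min F (\<lambda>T. T \<in> hyperplanes_through P) S}"
    then have "S \<in> hyperplanes_through P" "F S \<le> \<mu> s\<^sub>0"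
      using mem val by (auto simp: is_arg_min_def not_less)
    then show "S \<in> {hyperplane_at P (f s\<^sub>0)}"
      using uniq by simp
  next
    fix S assume "S \<in> {hyperplane_at P (f s\<^sub>0)}"
    then show "S \<in> {S. is_arg_min F (\<lambda>T. T \<in> hyperplanes_through P) S}"
      using mem val min by (auto simp: is_arg_min_def not_less)
  qed
qed

lemma arg_max_hyperplane_diagonal:
  fixes F :: "'a::euclidean_space set \<Rightarrow> real"
  assumes f: "orthonormal_basis I f" and s0: "s\<^sub>0 \<in> I"
    and less: "\<And>s. s \<in> I \<Longrightarrow> s \<noteq> s\<^sub>0 \<Longrightarrow> \<mu> s < \<mu> s\<^sub>0"
    and F: "\<And>u. norm u = 1 \<Longrightarrow> F (hyperplane_at P u) = (\<Sum>s\<in>I. \<mu> s * (u \<bullet> f s)\<^sup>2)"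
  shows "{S. is_arg_max F (\<lambda>T. T \<in> hyperplanes_through P) S} = {hyperplane_at P (f s\<^sub>0)}"
proof -
  have "{S. is_arg_min (\<lambda>S. - F S) (\<lambda>T. T \<in> hyperplanes_through P) S} = {hyperplane_at P (f s\<^sub>0)}"
    by (rule arg_min_hyperplane_diagonal[OF f s0, where \<mu> = "\<lambda>s. - \<mu> s"])
      (use less F in \<open>auto simp: sum_negf\<close>)
  then show ?thesis
    by (simp add: is_arg_min_def is_arg_max_def)
qed

section \<open>Tangent hyperplanes of the confocal quadrics\<close>

text \<open>Differentiate the constant function \<open>g \<circ> \<gamma>\<close>. The factor 2 is the one that
  arises from a quadratic form with normal \<open>n\<close>.\<close>

lemma tangent_at_level_set_subset:
  fixes g :: "'a::euclidean_space \<Rightarrow> real"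
  assumes g: "(g has_derivative (\<lambda>h. 2 * (n \<bullet> h))) (at P)"
  shows "tangent_at {x. g x = d} P \<subseteq> hyperplane_at P n"
proof
  fix y assume "y \<in> tangent_at {x. g x = d} P"
  then obtain v \<gamma> where y: "y = P + v" and \<gamma>0: "\<gamma> 0 = P"
    and ev: "\<forall>\<^sub>F t :: real in nhds 0. g (\<gamma> t) = d"
    and der: "(\<gamma> has_vector_derivative v) (at 0)"
    by (auto simp: tangent_at_def)
  have "((\<lambda>t. g (\<gamma> t)) has_derivative (\<lambda>t. 2 * (n \<bullet> (t *\<^sub>R v)))) (at 0)"
    using has_derivative_compose[OF der[unfolded has_vector_derivative_def], of g "\<lambda>h. 2 * (n \<bullet> h)"] g \<gamma>0
    by simp
  moreover have "((\<lambda>t. g (\<gamma> t)) has_derivative (\<lambda>t. 0)) (at 0)"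
  proof (rule has_derivative_transform_eventually)
    show "\<forall>\<^sub>F t in at 0. d = g (\<gamma> t)" "d = g (\<gamma> 0)"
      using ev unfolding eventually_nhds_conv_at by (auto elim: eventually_mono)
  qed auto
  ultimately have "(\<lambda>t. 2 * (n \<bullet> (t *\<^sub>R v))) = (\<lambda>t. 0)"
    by (rule has_derivative_unique)
  from fun_cong[OF this, of 1] show "y \<in> hyperplane_at P n"
    by (simp add: y mem_hyperplane_at)
qed

lemma tangent_at_hyperplane:
  assumes "n \<bullet> (P - C) = 0"
  shows "tangent_at {x. n \<bullet> (x - C) = 0} P = hyperplane_at P n"
proof
  have "((\<lambda>x. 2 * (n \<bullet> (x - C))) has_derivative (\<lambda>h. 2 * (n \<bullet> h))) (at P)"
    by (auto intro!: derivative_eq_intros)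
  from tangent_at_level_set_subset[OF this, of 0]
  show "tangent_at {x. n \<bullet> (x - C) = 0} P \<subseteq> hyperplane_at P n" by simp
next
  show "hyperplane_at P n \<subseteq> tangent_at {x. n \<bullet> (x - C) = 0} P"
  proof
    fix y assume y: "y \<in> hyperplane_at P n"
    define \<gamma> where "\<gamma> t = P + t *\<^sub>R (y - P)" for t :: real
    have "(\<gamma> has_vector_derivative (y - P)) (at 0)"
      unfolding \<gamma>_def by (auto intro!: derivative_eq_intros)
    moreover have "n \<bullet> (\<gamma> t - C) = 0" for t
      using y assms by (simp add: \<gamma>_def mem_hyperplane_at inner_diff_right inner_add_right)
    ultimately show "y \<in> tangent_at {x. n \<bullet> (x - C) = 0} P"
      unfolding tangent_at_def
      by (intro CollectI exI[of _ "y - P"] conjI exI[of _ \<gamma>]) (auto simp: \<gamma>_def)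
  qed
qed

text \<open>For the inclusion from right to left, an explicit curve takes the place of the implicit function
  theorem. If \<open>v\<close> is orthogonal to the normal, the quadratic form has the value
  \<open>1 + t\<^sup>2 * q v\<close> at \<open>P - C + t *\<^sub>R v\<close>, without a term linear in \<open>t\<close>. Dividing by the square
  root of this value puts the point on the quadric and leaves the velocity \<open>v\<close> at 0
  unchanged.\<close>

lemma tangent_at_central_quadric:
  fixes e :: "'i \<Rightarrow> 'a::euclidean_space" and b :: "'i \<Rightarrow> real"
  assumes n: "n = (\<Sum>i\<in>I. (b i * ((P - C) \<bullet> e i)) *\<^sub>R e i)"
    and P: "(\<Sum>i\<in>I. b i * ((P - C) \<bullet> e i)\<^sup>2) = 1"
  shows "tangent_at {x. (\<Sum>i\<in>I. b i * ((x - C) \<bullet> e i)\<^sup>2) = 1} P = hyperplane_at P n"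
proof
  have "((\<lambda>x. \<Sum>i\<in>I. b i * ((x - C) \<bullet> e i)\<^sup>2) has_derivative (\<lambda>h. 2 * (n \<bullet> h))) (at P)"
    unfolding n
    by (auto intro!: derivative_eq_intros sum.cong
        simp: inner_sum_right inner_diff_right sum_distrib_left algebra_simps inner_commute)
  then show "tangent_at {x. (\<Sum>i\<in>I. b i * ((x - C) \<bullet> e i)\<^sup>2) = 1} P \<subseteq> hyperplane_at P n"
    by (rule tangent_at_level_set_subset)
next
  show "hyperplane_at P n \<subseteq> tangent_at {x. (\<Sum>i\<in>I. b i * ((x - C) \<bullet> e i)\<^sup>2) = 1} P"
  proof
    fix y assume y: "y \<in> hyperplane_at P n"
    define v where "v = y - P"
    define q where "q z = (\<Sum>i\<in>I. b i * (z \<bullet> e i)\<^sup>2)" for z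
    have nv: "(\<Sum>i\<in>I. b i * ((P - C) \<bullet> e i) * (v \<bullet> e i)) = 0"
      using y by (simp add: mem_hyperplane_at n v_def inner_sum_left inner_commute[of "e _" "y - P"])
    have q_line: "q (P - C + t *\<^sub>R v) = 1 + t\<^sup>2 * q v" for t
    proof -
      have "q (P - C + t *\<^sub>R v) = (\<Sum>i\<in>I. b i * ((P - C) \<bullet> e i)\<^sup>2)
          + 2 * t * (\<Sum>i\<in>I. b i * ((P - C) \<bullet> e i) * (v \<bullet> e i)) + t\<^sup>2 * q v"
        unfolding q_def sum_distrib_left sum.distrib[symmetric]
        by (intro sum.cong) (auto simp: inner_add_left power2_eq_square algebra_simps)
      then show ?thesis by (simp add: P nv)
    qed
    have q_scale: "q (c *\<^sub>R z) = c\<^sup>2 * q z" for c z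
      by (simp add: q_def sum_distrib_left power_mult_distrib mult_ac)
    define \<gamma> where "\<gamma> t = C + (1 / sqrt (1 + t\<^sup>2 * q v)) *\<^sub>R (P - C + t *\<^sub>R v)" for t :: real
    have "(\<gamma> has_vector_derivative v) (at 0)"
      unfolding \<gamma>_def by (auto intro!: derivative_eq_intros)
    moreover have "\<forall>\<^sub>F t in nhds 0. 0 < 1 + t\<^sup>2 * q v"
    proof -
      have "((\<lambda>t::real. 1 + t\<^sup>2 * q v) \<longlongrightarrow> 1 + 0\<^sup>2 * q v) (nhds 0)"
        by (intro tendsto_intros) (simp add: filterlim_ident)
      then show ?thesis
        by (rule order_tendstoD(1)) simp
    qed
    then have "\<forall>\<^sub>F t in nhds 0. q (\<gamma> t - C) = 1"
    proof eventually_elim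
      case (elim t)
      then show ?case
        by (simp add: \<gamma>_def q_scale q_line power_divide)
    qed
    ultimately show "y \<in> tangent_at {x. (\<Sum>i\<in>I. b i * ((x - C) \<bullet> e i)\<^sup>2) = 1} P"
      unfolding tangent_at_def q_def
      by (intro CollectI exI[of _ v] conjI exI[of _ \<gamma>]) (auto simp: \<gamma>_def v_def)
  qed
qed

text \<open>The third claim says, in coordinates, that \<open>n\<close> is an eigenvector of
  \<open>diag \<alpha> - p p\<^sup>T\<close> for the eigenvalue \<open>l\<close>, where \<open>p = P - C\<close>. For the normal with coordinates
  \<open>p\<^sub>i / (\<alpha>\<^sub>i - l)\<close> the equation of the quadric is \<open>p \<bullet> n = 1\<close>, and then
  \<open>(\<alpha>\<^sub>i - l) * n\<^sub>i = p\<^sub>i = (p \<bullet> n) * p\<^sub>i\<close>. For a degenerate member, \<open>p \<bullet> e\<^sub>i = 0\<close> for its normal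
  \<open>e\<^sub>i\<close>, so the rank-one part does not see \<open>e\<^sub>i\<close>.\<close>

lemma pencil_quadric_tangent:
  fixes C P :: "'a::euclidean_space"
  assumes e: "orthonormal_basis {1..DIM('a)} e" and inj: "inj_on \<alpha> {1..DIM('a)}"
    and P: "P \<in> pencil_quadric \<alpha> C e l"
  obtains n where "norm n = 1" "tangent_at (pencil_quadric \<alpha> C e l) P = hyperplane_at P n"
    "\<And>i. i \<in> {1..DIM('a)} \<Longrightarrow>
      \<alpha> i * (n \<bullet> e i) - ((P - C) \<bullet> n) * ((P - C) \<bullet> e i) = l * (n \<bullet> e i)"
proof (cases "l \<in> \<alpha> ` {1..DIM('a)}")
  case True
  then obtain i where i: "i \<in> {1..DIM('a)}" "l = \<alpha> i" by blast
  have Q: "pencil_quadric \<alpha> C e l = {x. e i \<bullet> (x - C) = 0}"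
    using True i inj by (auto simp: pencil_quadric_def coord_def inner_commute dest: inj_onD)
  have Pi: "e i \<bullet> (P - C) = 0"
    using P Q by simp
  show ?thesis
  proof
    show "norm (e i) = 1" by (rule orthonormal_basisD(3)[OF e i(1)])
    show "tangent_at (pencil_quadric \<alpha> C e l) P = hyperplane_at P (e i)"
      unfolding Q by (rule tangent_at_hyperplane[OF Pi])
    show "\<alpha> j * (e i \<bullet> e j) - ((P - C) \<bullet> e i) * ((P - C) \<bullet> e j) = l * (e i \<bullet> e j)"
      if "j \<in> {1..DIM('a)}" for j
      using orthonormal_basisD(2)[OF e i(1) that] Pi i(2) by (auto simp: inner_commute)
  qed
next
  case False
  define b where "b i = 1 / (\<alpha> i - l)" for i
  define n where "n = (\<Sum>i=1..DIM('a). (b i * ((P - C) \<bullet> e i)) *\<^sub>R e i)"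
  have Q: "pencil_quadric \<alpha> C e l = {x. (\<Sum>i=1..DIM('a). b i * ((x - C) \<bullet> e i)\<^sup>2) = 1}"
    using False by (simp add: pencil_quadric_def coord_def b_def)
  have P1: "(\<Sum>i=1..DIM('a). b i * ((P - C) \<bullet> e i)\<^sup>2) = 1"
    using P Q by simp
  have n_coord: "n \<bullet> e i = b i * ((P - C) \<bullet> e i)" if i: "i \<in> {1..DIM('a)}" for i
  proof -
    have "n \<bullet> e i = (\<Sum>j=1..DIM('a). if j = i then b j * ((P - C) \<bullet> e j) else 0)"
      unfolding n_def inner_sum_left
      by (intro sum.cong refl) (simp add: orthonormal_basisD(2)[OF e _ i])
    then show ?thesis using i by simp
  qed
  have Pn: "(P - C) \<bullet> n = 1"
    using P1 by (simp add: n_def inner_sum_right power2_eq_square mult_ac)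
  then have n0: "n \<noteq> 0" by auto
  have eig: "\<alpha> i * (n \<bullet> e i) - ((P - C) \<bullet> n) * ((P - C) \<bullet> e i) = l * (n \<bullet> e i)"
    if i: "i \<in> {1..DIM('a)}" for i
  proof -
    have "\<alpha> i - l \<noteq> 0" using False i by auto
    then have "(\<alpha> i - l) * (n \<bullet> e i) = (P - C) \<bullet> e i"
      by (simp add: n_coord[OF i] b_def)
    then show ?thesis
      by (simp add: Pn left_diff_distrib)
  qed
  show ?thesis
  proof
    show "norm (sgn n) = 1" using n0 by (simp add: norm_sgn)
    show "tangent_at (pencil_quadric \<alpha> C e l) P = hyperplane_at P (sgn n)"
      using n0 tangent_at_central_quadric[OF n_def P1]
      by (simp add: Q sgn_div_norm hyperplane_at_scaleR)
    show "\<alpha> i * (sgn n \<bullet> e i) - ((P - C) \<bullet> sgn n) * ((P - C) \<bullet> e i) = l * (sgn n \<bullet> e i)"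
      if "i \<in> {1..DIM('a)}" for i
    proof -
      have "x * (c * y) - (c * z) * w = l * (c * y)" if "x * y - z * w = l * y" for x y z w c :: real
        using that by algebra
      from this[OF eig[OF that]] show ?thesis
        by (simp only: sgn_div_norm inner_scaleR_left inner_scaleR_right)
    qed
  qed
qed

text \<open>For a nondegenerate parameter the Jacobi polynomial is the equation of the quadric with the
  denominators cleared. At \<open>l = \<alpha>\<^sub>i\<close> all products that contain the factor \<open>\<alpha>\<^sub>i - l\<close> vanish and a
  nonzero multiple of the squared coordinate \<open>x\<^sub>i\<^sup>2\<close> remains.\<close>

lemma mem_pencil_quadric_iff_jacobi:
  fixes C P :: "'a::euclidean_space"
  assumes inj: "inj_on \<alpha> {1..DIM('a)}"
  shows "P \<in> pencil_quadric \<alpha> C e l \<longleftrightarrow> jacobi_function (DIM('a)) \<alpha> (coord C e P) l = 0"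
proof (cases "l \<in> \<alpha> ` {1..DIM('a)}")
  case True
  let ?I = "{1..DIM('a)}"
  obtain i where i: "i \<in> ?I" "l = \<alpha> i" using True by blast
  have mem: "P \<in> pencil_quadric \<alpha> C e l \<longleftrightarrow> coord C e P i = 0"
    using True i inj by (auto simp: pencil_quadric_def dest: inj_onD)
  have "(\<Prod>j\<in>?I. \<alpha> j - l) = 0"
    using i by (intro prod_zero) auto
  moreover have "(\<Sum>j\<in>?I. (coord C e P j)\<^sup>2 * (\<Prod>h\<in>?I - {j}. \<alpha> h - l)) =
      (\<Sum>j\<in>?I. if j = i then (coord C e P j)\<^sup>2 * (\<Prod>h\<in>?I - {j}. \<alpha> h - l) else 0)"
    using i by (intro sum.cong) (auto intro!: prod_zero bexI[of _ i])
  moreover have "(\<Prod>h\<in>?I - {i}. \<alpha> h - l) \<noteq> 0"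
    using i inj by (auto dest: inj_onD)
  ultimately show ?thesis
    unfolding jacobi_function_def mem using i(1) by (simp del: prod_zero_iff)
next
  case False
  let ?I = "{1..DIM('a)}"
  have nz: "\<alpha> j - l \<noteq> 0" if "j \<in> ?I" for j using False that by auto
  have "jacobi_function (DIM('a)) \<alpha> (coord C e P) l =
      (\<Prod>j\<in>?I. \<alpha> j - l) * (1 - (\<Sum>j\<in>?I. (coord C e P j)\<^sup>2 / (\<alpha> j - l)))"
  proof -
    have "(coord C e P j)\<^sup>2 * (\<Prod>h\<in>?I - {j}. \<alpha> h - l) =
        (\<Prod>h\<in>?I. \<alpha> h - l) * ((coord C e P j)\<^sup>2 / (\<alpha> j - l))" if j: "j \<in> ?I" for j
      using nz[OF j] by (subst prod.remove[OF finite_atLeastAtMost j]) simp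
    then have "(\<Sum>j\<in>?I. (coord C e P j)\<^sup>2 * (\<Prod>h\<in>?I - {j}. \<alpha> h - l)) =
        (\<Sum>j\<in>?I. (\<Prod>h\<in>?I. \<alpha> h - l) * ((coord C e P j)\<^sup>2 / (\<alpha> j - l)))"
      by (rule sum.cong[OF refl])
    then show ?thesis
      by (simp only: jacobi_function_def right_diff_distrib mult_1_right flip: sum_distrib_left)
  qed
  moreover have "(\<Prod>j\<in>?I. \<alpha> j - l) \<noteq> 0" using nz by simp
  ultimately show ?thesis
    using False by (auto simp: pencil_quadric_def)
qed

section \<open>The moment as a quadratic form in the unit normal\<close>

lemma sum_centered:
  assumes "total_mass N m \<noteq> 0"
  shows "(\<Sum>j=1..N. m j *\<^sub>R (M j - mass_center N m M)) = 0"
proof -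
  have "(\<Sum>j=1..N. m j *\<^sub>R (M j - mass_center N m M)) =
      (\<Sum>j=1..N. m j *\<^sub>R M j) - total_mass N m *\<^sub>R mass_center N m M"
    by (simp only: scaleR_diff_right sum_subtractf total_mass_def scaleR_sum_left)
  then show ?thesis
    using assms by (simp add: mass_center_def)
qed

text \<open>The parallel axis theorem: expanding \<open>M\<^sub>j - P = (M\<^sub>j - C) - (P - C)\<close>, the mixed term is a
  multiple of the first moment about the center of masses, which is zero.\<close>

lemma hyperplanar_moment_steiner:
  assumes u: "norm u = 1" and mass: "total_mass N m \<noteq> 0"
  shows "hyperplanar_moment N m M (hyperplane_at P u) =
    central_operator N m M u \<bullet> u + total_mass N m * ((P - mass_center N m M) \<bullet> u)\<^sup>2"
proof -
  define C where "C = mass_center N m M"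
  have "hyperplanar_moment N m M (hyperplane_at P u) = (\<Sum>j=1..N. m j * (u \<bullet> (M j - P))\<^sup>2)"
    by (simp add: hyperplanar_moment_def infdist_hyperplane_at[OF u])
  also have "\<dots> = (\<Sum>j=1..N. m j * ((M j - C) \<bullet> u) * ((M j - C) \<bullet> u))
      - 2 * ((P - C) \<bullet> u) * ((\<Sum>j=1..N. m j *\<^sub>R (M j - C)) \<bullet> u)
      + (\<Sum>j=1..N. m j) * ((P - C) \<bullet> u)\<^sup>2"
    unfolding inner_sum_left sum_distrib_left sum_distrib_right
      sum.distrib[symmetric] sum_subtractf[symmetric]
    by (intro sum.cong) (auto simp: power2_eq_square inner_diff_left inner_diff_right
        inner_commute algebra_simps)
  finally show ?thesis
    using sum_centered[OF mass, of M]
    by (simp add: central_operator_inner total_mass_def C_def)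
qed

lemma central_operator_principal:
  fixes e :: "nat \<Rightarrow> 'a::euclidean_space"
  assumes axes: "principal_axes N m M J e"
  shows "central_operator N m M u \<bullet> u = (\<Sum>i=1..DIM('a). J i * (u \<bullet> e i)\<^sup>2)"
proof -
  have e: "orthonormal_basis {1..DIM('a)} e"
    using axes by (auto simp: principal_axes_def orthonormal_basis_def)
  have "central_operator N m M u \<bullet> e i = J i * (u \<bullet> e i)" if "i \<in> {1..DIM('a)}" for i
  proof -
    have "central_operator N m M u \<bullet> e i = central_operator N m M (e i) \<bullet> u"
      by (simp add: central_operator_inner mult_ac)
    then show ?thesis
      using axes that by (simp add: principal_axes_def inner_commute)
  qed
  then show ?thesis
    using orthonormal_basis_inner[OF e, of "central_operator N m M u" u]
    by (simp add: power2_eq_square mult_ac)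
qed

text \<open>Points not contained in one hyperplane exclude \<open>N = 0\<close>, because the empty set is contained in every hyperplane.\<close>

lemma total_mass_pos:
  fixes M :: "nat \<Rightarrow> 'a::euclidean_space"
  assumes pos: "\<forall>j\<in>{1..N}. 0 < m j"
    and not_in_hyperplane: "\<not> (\<exists>S. hyperplane S \<and> M ` {1..N} \<subseteq> S)"
  shows "0 < total_mass N m"
proof -
  obtain b :: 'a where "b \<in> Basis" using nonempty_Basis by blast
  then have "hyperplane {x. b \<bullet> x = 0}"
    unfolding hyperplane_def using nonzero_Basis by blast
  with not_in_hyperplane have "{1..N} \<noteq> {}" by blast
  then show ?thesis
    unfolding total_mass_def using pos by (intro sum_pos) auto
qed

text \<open>One formula for all indices; at index 1 the correction is zero.\<close>

lemma pencil_coeff_eq: "pencil_coeff mass J s = (2 * J 1 - J s) / mass"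
  by (simp add: pencil_coeff_def a_sq_def diff_divide_distrib)

theorem theorem4p3:
  fixes M :: "nat \<Rightarrow> real ^ 'n"
    and m :: "nat \<Rightarrow> real"
    and N k :: nat
    and J lam \<alpha> :: "nat \<Rightarrow> real"
    and e :: "nat \<Rightarrow> real ^ 'n"
    and C P :: "real ^ 'n"
    and Q :: "real \<Rightarrow> (real ^ 'n) set"
  assumes dim: "k = CARD('n)"
    and masses_pos: "\<forall>j\<in>{1..N}. 0 < m j"
    and not_in_hyperplane: "\<not> (\<exists>S. hyperplane S \<and> M ` {1..N} \<subseteq> S)"
    and center: "C = mass_center N m M"
    and axes: "principal_axes N m M J e"
    and J_pos: "0 < J 1"
    and J_strict: "strict_mono_on {1..k} J"
    and alpha: "\<alpha> = pencil_coeff (total_mass N m) J"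
    and pencil: "Q = pencil_quadric \<alpha> C e"
    and jacobi: "jacobi_coordinates k \<alpha> (coord C e P) lam"
  shows "bij_betw (\<lambda>s. Q (lam s)) {1..k} {S \<in> range Q. P \<in> S} \<and>
         (\<forall>s\<in>{1..k}. \<forall>t\<in>{1..k}. s \<noteq> t \<longrightarrow>
           orthogonal_hyperplanes (tangent_at (Q (lam s)) P) (tangent_at (Q (lam t)) P)) \<and>
         {S. critical_hyperplane (hyperplanar_moment N m M) P S} =
           (\<lambda>s. tangent_at (Q (lam s)) P) ` {1..k} \<and>
         {S. best_fit N m M (hyperplanes_through P) S} = {tangent_at (Q (lam k)) P} \<and>
         {S. worst_fit N m M (hyperplanes_through P) S} = {tangent_at (Q (lam 1)) P}"
proof -
  define mass where "mass = total_mass N m"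
  define p where "p = P - C"
  have k: "k = DIM(real ^ 'n)" by (simp add: dim)
  have k1: "1 \<in> {1..k}" "k \<in> {1..k}" by (simp_all add: dim Suc_le_eq)
  have mass: "0 < mass"
    unfolding mass_def by (rule total_mass_pos[OF masses_pos not_in_hyperplane])
  have e: "orthonormal_basis {1..k} e"
    using axes by (auto simp: principal_axes_def orthonormal_basis_def k)
  have alpha': "\<alpha> i = (2 * J 1 - J i) / mass" for i
    by (simp add: alpha pencil_coeff_eq mass_def)
  have inj: "inj_on \<alpha> {1..k}"
  proof (rule inj_onI)
    fix s t assume st: "s \<in> {1..k}" "t \<in> {1..k}" "\<alpha> s = \<alpha> t"
    then have "J s = J t"
      using mass by (simp add: alpha')
    with st show "s = t"
      using strict_mono_on_imp_inj_on[OF J_strict] by (blast dest: inj_onD)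
  qed
  have lam_mono: "lam s < lam t" if "s \<in> {1..k}" "t \<in> {1..k}" "s < t" for s t
    using jacobi that unfolding jacobi_coordinates_def by (blast intro: strict_mono_onD)
  have lam_inj: "inj_on lam {1..k}"
    using jacobi strict_mono_on_imp_inj_on unfolding jacobi_coordinates_def by blast
  have mem: "P \<in> Q l \<longleftrightarrow> l \<in> lam ` {1..k}" for l
    using mem_pencil_quadric_iff_jacobi[of \<alpha> P C e l] jacobi inj
    unfolding pencil k jacobi_coordinates_def by blast

  \<comment> \<open>The unit normals at \<open>P\<close> of the \<open>k\<close> members of the pencil are eigenvectors of \<open>B\<close>.\<close>
  have "\<forall>s\<in>{1..k}. \<exists>n. norm n = 1 \<and> tangent_at (Q (lam s)) P = hyperplane_at P n \<and>
      (\<forall>i\<in>{1..k}. \<alpha> i * (n \<bullet> e i) - (p \<bullet> n) * (p \<bullet> e i) = lam s * (n \<bullet> e i))"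
  proof
    fix s assume "s \<in> {1..k}"
    then have "P \<in> pencil_quadric \<alpha> C e (lam s)"
      using mem unfolding pencil by blast
    then obtain n where "norm n = 1" "tangent_at (Q (lam s)) P = hyperplane_at P n"
      "\<And>i. i \<in> {1..k} \<Longrightarrow>
        \<alpha> i * (n \<bullet> e i) - (p \<bullet> n) * (p \<bullet> e i) = lam s * (n \<bullet> e i)"
      using pencil_quadric_tangent[OF e[unfolded k] inj[unfolded k]]
      unfolding pencil k p_def by metis
    then show "\<exists>n. norm n = 1 \<and> tangent_at (Q (lam s)) P = hyperplane_at P n \<and>
        (\<forall>i\<in>{1..k}. \<alpha> i * (n \<bullet> e i) - (p \<bullet> n) * (p \<bullet> e i) = lam s * (n \<bullet> e i))"
      by blast
  qed
  from bchoice[OF this] obtain f where f_norm: "\<And>s. s \<in> {1..k} \<Longrightarrow> norm (f s) = 1"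
    and f_tangent: "\<And>s. s \<in> {1..k} \<Longrightarrow> tangent_at (Q (lam s)) P = hyperplane_at P (f s)"
    and f_eig: "\<And>s i. s \<in> {1..k} \<Longrightarrow> i \<in> {1..k} \<Longrightarrow>
      \<alpha> i * (f s \<bullet> e i) - (p \<bullet> f s) * (p \<bullet> e i) = lam s * (f s \<bullet> e i)"
    by blast

  define B where "B u = (\<Sum>i=1..k. (\<alpha> i * (u \<bullet> e i)) *\<^sub>R e i) - (p \<bullet> u) *\<^sub>R p" for u
  have B_inner: "B u \<bullet> w = (\<Sum>i=1..k. \<alpha> i * (u \<bullet> e i) * (w \<bullet> e i)) - (p \<bullet> u) * (p \<bullet> w)" for u w
    by (simp add: B_def inner_diff_left inner_sum_left inner_commute[of "e _" w])
  have B_sym: "B u \<bullet> w = B w \<bullet> u" for u w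
    by (simp add: B_inner mult_ac)
  have B_eig: "B (f s) = lam s *\<^sub>R f s" if s: "s \<in> {1..k}" for s
  proof (rule orthonormal_basis_eqI[OF e])
    fix i assume i: "i \<in> {1..k}"
    have "(\<Sum>j=1..k. \<alpha> j * (f s \<bullet> e j) * (e i \<bullet> e j)) =
        (\<Sum>j=1..k. if j = i then \<alpha> j * (f s \<bullet> e j) else 0)"
      using orthonormal_basisD(2)[OF e i] by (intro sum.cong) auto
    then show "B (f s) \<bullet> e i = (lam s *\<^sub>R f s) \<bullet> e i"
      using f_eig[OF s i] i by (simp add: B_inner)
  qed
  \<comment> \<open>Eigenvectors of a symmetric operator for distinct eigenvalues are orthogonal.\<close>
  have f_orth: "f s \<bullet> f t = 0" if st: "s \<in> {1..k}" "t \<in> {1..k}" "s \<noteq> t" for s t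
  proof -
    have "lam s * (f s \<bullet> f t) = lam t * (f s \<bullet> f t)"
      using B_sym[of "f s" "f t"] B_eig st by (simp add: inner_commute)
    moreover have "lam s \<noteq> lam t"
      using inj_onD[OF lam_inj] st by blast
    ultimately show ?thesis by simp
  qed
  have f: "orthonormal_basis {1..k} f"
    unfolding orthonormal_basis_def using f_orth f_norm by (auto simp: k norm_eq_1)
  have f0: "f s \<noteq> 0" if "s \<in> {1..k}" for s
    using f_norm[OF that] by auto

  \<comment> \<open>On unit normals the moment is the quadratic form of \<open>2 * J 1 - mass * B\<close>, with these eigenvalues.\<close>
  define \<mu> where "\<mu> s = 2 * J 1 - mass * lam s" for s
  have moment: "hyperplanar_moment N m M (hyperplane_at P u) = (\<Sum>s=1..k. \<mu> s * (u \<bullet> f s)\<^sup>2)"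
    if u: "norm u = 1" for u
  proof -
    have J: "J i = 2 * J 1 - mass * \<alpha> i" for i
      using mass by (simp add: alpha')
    have uu: "(\<Sum>i=1..k. (u \<bullet> e i)\<^sup>2) = 1" "(\<Sum>i=1..k. (u \<bullet> f i)\<^sup>2) = 1"
      using orthonormal_basis_inner[OF e, of u u] orthonormal_basis_inner[OF f, of u u] u
      by (simp_all add: norm_eq_1 power2_eq_square)
    have Bf: "B u \<bullet> f s = lam s * (u \<bullet> f s)" if "s \<in> {1..k}" for s
      using B_sym[of u "f s"] B_eig[OF that] by (simp add: inner_commute)
    have "hyperplanar_moment N m M (hyperplane_at P u) =
        (\<Sum>i=1..k. J i * (u \<bullet> e i)\<^sup>2) + mass * (p \<bullet> u)\<^sup>2"
      using hyperplanar_moment_steiner[OF u, of N m M P] central_operator_principal[OF axes, of u]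
        mass by (simp add: mass_def p_def center k)
    also have "(\<Sum>i=1..k. J i * (u \<bullet> e i)\<^sup>2) =
        2 * J 1 * (\<Sum>i=1..k. (u \<bullet> e i)\<^sup>2) - mass * (\<Sum>i=1..k. \<alpha> i * (u \<bullet> e i) * (u \<bullet> e i))"
      unfolding sum_distrib_left sum_subtractf[symmetric]
      by (intro sum.cong refl, subst J) (simp add: power2_eq_square algebra_simps)
    also have "\<dots> + mass * (p \<bullet> u)\<^sup>2 = 2 * J 1 - mass * (B u \<bullet> u)"
      by (simp only: uu(1) B_inner) (simp add: power2_eq_square algebra_simps)
    also have "B u \<bullet> u = (\<Sum>s=1..k. lam s * (u \<bullet> f s)\<^sup>2)"
      using orthonormal_basis_inner[OF f, of "B u" u] Bf
      by (simp add: power2_eq_square mult_ac)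
    also have "2 * J 1 - mass * \<dots> = 2 * J 1 * (\<Sum>s=1..k. (u \<bullet> f s)\<^sup>2) - mass * \<dots>"
      by (simp only: uu mult_1_right)
    also have "\<dots> = (\<Sum>s=1..k. \<mu> s * (u \<bullet> f s)\<^sup>2)"
      unfolding sum_distrib_left sum_subtractf[symmetric] \<mu>_def by (simp add: algebra_simps)
    finally show ?thesis .
  qed
  have \<mu>_mono: "\<mu> t < \<mu> s" if "s \<in> {1..k}" "t \<in> {1..k}" "s < t" for s t
    using lam_mono[OF that] mass by (simp add: \<mu>_def)
  have \<mu>_inj: "inj_on \<mu> {1..k}"
  proof (rule inj_onI)
    fix s t assume st: "s \<in> {1..k}" "t \<in> {1..k}" "\<mu> s = \<mu> t"
    then have "lam s = lam t"
      using mass by (simp add: \<mu>_def)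
    with st show "s = t"
      using lam_inj by (blast dest: inj_onD)
  qed

  have "bij_betw (\<lambda>s. Q (lam s)) {1..k} {S \<in> range Q. P \<in> S}"
  proof (rule bij_betw_imageI)
    show "inj_on (\<lambda>s. Q (lam s)) {1..k}"
    \<comment> \<open>Equal members of the pencil would have equal tangent hyperplanes at \<open>P\<close>, but those are orthogonal.\<close>
    proof (rule inj_onI, rule ccontr)
      fix s t assume st: "s \<in> {1..k}" "t \<in> {1..k}" "Q (lam s) = Q (lam t)" "s \<noteq> t"
      then have "hyperplane_at P (f s) = hyperplane_at P (f t)"
        using f_tangent by metis
      then show False
        using hyperplane_at_orthogonal_neq[OF f0[OF st(1)] f_orth[OF st(1,2,4)], of P] by simp
    qed
    show "(\<lambda>s. Q (lam s)) ` {1..k} = {S \<in> range Q. P \<in> S}"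
      using mem by (auto simp: image_iff)
  qed
  moreover have "orthogonal_hyperplanes (tangent_at (Q (lam s)) P) (tangent_at (Q (lam t)) P)"
    if "s \<in> {1..k}" "t \<in> {1..k}" "s \<noteq> t" for s t
    using that by (simp only: f_tangent) (intro orthogonal_hyperplanes_at f0 f_orth)
  moreover have "{S. critical_hyperplane (hyperplanar_moment N m M) P S} =
      (\<lambda>s. tangent_at (Q (lam s)) P) ` {1..k}"
    using critical_hyperplane_diagonal_iff[OF f \<mu>_inj moment] f_tangent
    by (auto simp: image_iff)
  moreover have "{S. best_fit N m M (hyperplanes_through P) S} = {tangent_at (Q (lam k)) P}"
    unfolding best_fit_def f_tangent[OF k1(2)]
    by (rule arg_min_hyperplane_diagonal[OF f k1(2) _ moment]) (use \<mu>_mono k1 in auto)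
  moreover have "{S. worst_fit N m M (hyperplanes_through P) S} = {tangent_at (Q (lam 1)) P}"
    unfolding worst_fit_def f_tangent[OF k1(1)]
    by (rule arg_max_hyperplane_diagonal[OF f k1(1) _ moment]) (use \<mu>_mono k1 in auto)
  ultimately show ?thesis by blast
qed

end
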